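(* Let $(r,s)$ be a pair of positive integers with $|r-s|\le 1$ and $(r,s)\ne(1,2)$. Then there exists a connected graph $G$ such that $\alpha'_g(G)=r$ and $\hat\alpha'_g(G)=s$.
   Context: Graphs are finite and simple. The matching game on a graph $G$: two players, Max and Min, alternately add edges of $G$ to a set of chosen edges that must always remain a matching; the game ends when the chosen edges form a maximal matching of $G$ (no further edge can be added). Max wants the final matching to be large, Min wants it to be small. $\alpha'_g(G)$ denotes the size of the final matching under optimal play when Max moves first, and $\hat\alpha'_g(G)$ denotes the size of the final matching under optimal play when Min moves first. *)

theory Defs
  imports Main "Graph_Theory.Graph_Theory"
begin

text \<open>A finite simple graph is a \<open>pair_graph\<close>, i.e. a finite, loop-free and symmetric set of
  ordered pairs; each undirected edge \<open>{u, v}\<close> is represented there by the two arcs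
  \<open>(u, v)\<close> and \<open>(v, u)\<close>. Matchings are sets of undirected edges.\<close>

definition uedges :: "'a pair_pre_digraph \<Rightarrow> 'a set set" where
  "uedges G = {{u, v} | u v. (u, v) \<in> parcs G}"

definition matching :: "'a set set \<Rightarrow> 'a set set \<Rightarrow> bool" where
  "matching E M \<longleftrightarrow> M \<subseteq> E \<and> pairwise disjnt M"

definition legal_moves :: "'a set set \<Rightarrow> 'a set set \<Rightarrow> 'a set set" where
  "legal_moves E M = {e \<in> E - M. matching E (insert e M)}"

datatype player = Maximizer | Minimizer

text \<open>The minimax value of the position in which \<open>M\<close> has been chosen and player \<open>p\<close> is to move:
  the size of the final matching under optimal play from there on. The disjunct
  \<open>infinite E\<close> is only there to make the function total.\<close>

function game_value :: "'a set set \<Rightarrow> player \<Rightarrow> 'a set set \<Rightarrow> nat" where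
  "game_value E p M =
    (if infinite E \<or> legal_moves E M = {} then card M
     else case p of
       Maximizer \<Rightarrow> (MAX e\<in>legal_moves E M. game_value E Minimizer (insert e M))
     | Minimizer \<Rightarrow> (MIN e\<in>legal_moves E M. game_value E Maximizer (insert e M)))"
  by pat_completeness auto
termination
proof (relation "measure (\<lambda>(E, p, M). card (E - M))", goal_cases)
  case 1
  show ?case by simp
next
  case (2 E p M e)
  then have "E - insert e M \<subset> E - M" "finite (E - M)"
    by (auto simp: legal_moves_def)
  then show ?case by (simp add: psubset_card_mono)
next
  case (3 E p M e)
  then have "E - insert e M \<subset> E - M" "finite (E - M)"
    by (auto simp: legal_moves_def)
  then show ?case by (simp add: psubset_card_mono)
qed

declare game_value.simps [simp del]

text \<open>\<open>\<alpha>'\<^sub>g(G)\<close> (Max moves first) and \<open>\<alpha>'\<^sub>g(G)\<close> with a hat (Min moves first).\<close>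

definition max_start_number :: "'a pair_pre_digraph \<Rightarrow> nat" where
  "max_start_number G = game_value (uedges G) Maximizer {}"

definition min_start_number :: "'a pair_pre_digraph \<Rightarrow> nat" where
  "min_start_number G = game_value (uedges G) Minimizer {}"

end

theory Submission
  imports Defs
begin

text \<open>Join two cliques \<open>P \<union> {a, d}\<close> and \<open>Q \<union> {b, c}\<close>, from which the edges \<open>{a, d}\<close> and \<open>{b, c}\<close> have been
  removed, by the edges \<open>{a, b}\<close> and \<open>{c, d}\<close>. Once neither a linking edge nor a missing edge remains
  among the unmatched vertices, both sides are complete and nothing is left to decide: the final
  matching is perfect iff both sides are even. If \<open>|P| = |Q|\<close>, the player who moves second controls
  this parity. A first move inside one side is mirrored on the other; after a move using one of
  \<open>a, b, c, d\<close> there are two answers that settle the game, with opposite parities. So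
  \<open>|P| = |Q| = m\<close> realizes \<open>(m + 1, m + 2)\<close>. Deleting \<open>a\<close> and \<open>b\<close>, that is, starting after the first
  move \<open>{a, b}\<close>, hands the control to the first player and realizes \<open>(m + 1, m)\<close>. Complete graphs
  realize \<open>(r, r)\<close>.\<close>

section \<open>The matching game on vertex sets\<close>

text \<open>\<open>E\<close> may contain edges that leave \<open>V\<close>, so a single family
  \<open>E\<close> yields all the example graphs by varying \<open>V\<close> alone.\<close>

definition induced_pair_graph :: "'a set set \<Rightarrow> 'a set \<Rightarrow> 'a pair_pre_digraph" where
  "induced_pair_graph E V = \<lparr>pverts = V, parcs = {(u, v). {u, v} \<in> E \<and> {u, v} \<subseteq> V}\<rparr>"

lemma induced_pair_graph_simps [simp]:
  "pverts (induced_pair_graph E V) = V"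
  "(u, v) \<in> parcs (induced_pair_graph E V) \<longleftrightarrow> {u, v} \<in> E \<and> u \<in> V \<and> v \<in> V"
  by (auto simp: induced_pair_graph_def)

lemma pair_graph_induced_pair_graph:
  assumes "finite V" and "\<And>e. e \<in> E \<Longrightarrow> card e = 2"
  shows "pair_graph (induced_pair_graph E V)"
proof -
  let ?G = "induced_pair_graph E V"
  have "parcs ?G \<subseteq> V \<times> V" by (auto simp: induced_pair_graph_def)
  then have "finite (parcs ?G)" by (rule finite_subset) (simp add: assms(1))
  moreover have "symmetric (with_proj ?G)"
    by (auto simp: symmetric_def insert_commute intro!: symI)
  moreover have "u \<noteq> v" if "(u, v) \<in> parcs ?G" for u v
    using assms(2)[of "{u, v}"] that by auto
  ultimately show ?thesis
    using assms(1) by unfold_locales (auto simp: induced_pair_graph_def)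
qed

lemma uedges_induced_pair_graph:
  assumes "\<And>e. e \<in> E \<Longrightarrow> card e = 2"
  shows "uedges (induced_pair_graph E V) = {e \<in> E. e \<subseteq> V}"
proof (intro equalityI subsetI)
  fix e assume "e \<in> {e \<in> E. e \<subseteq> V}"
  moreover from this obtain u v where "e = {u, v}"
    using assms[of e] by (auto simp: card_2_iff)
  ultimately show "e \<in> uedges (induced_pair_graph E V)"
    by (auto simp: uedges_def)
qed (auto simp: uedges_def)

text \<open>Arcs come in both directions, so reachability from a single root \<open>w\<close>
  suffices: any two vertices are joined through \<open>w\<close>.\<close>

lemma connected_induced_pair_graph:
  assumes "finite V" and "\<And>e. e \<in> E \<Longrightarrow> card e = 2" and "w \<in> V"
    and "\<And>v. v \<in> V \<Longrightarrow> (w, v) \<in> (parcs (induced_pair_graph E V))\<^sup>*"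
  shows "Digraph_Component.connected (with_proj (induced_pair_graph E V))"
proof -
  let ?G = "induced_pair_graph E V"
  interpret pair_graph ?G
    using assms(1,2) by (rule pair_graph_induced_pair_graph)
  have reach: "w \<rightarrow>\<^sup>*\<^bsub>with_proj ?G\<^esub> v" if "v \<in> V" for v
    using assms(4)[OF that]
  proof induction
    case base
    then show ?case using assms(3) by simp
  next
    case (step y z)
    from step.IH step.hyps(2) show ?case by (rule reachable_adj_trans)
  qed
  have "u \<rightarrow>\<^sup>*\<^bsub>with_proj ?G\<^esub> v" if "u \<in> V" "v \<in> V" for u v
    using symmetric_reachable'[OF reach[OF that(1)]] reach[OF that(2)] by (rule reachable_trans)
  then show ?thesis
    unfolding Digraph_Component.connected_def using assms(3)
    by (intro strongly_connectedI reachable_mk_symmetricI) auto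
qed

section \<open>Positions and forcing strategies\<close>

text \<open>A position is the set \<open>S\<close> of unmatched vertices. The predicate says that one player can force
  the final set of unmatched vertices to satisfy \<open>Q\<close>; the flag tells whether it is that player's
  turn.\<close>

inductive can_force :: "'a set set \<Rightarrow> ('a set \<Rightarrow> bool) \<Rightarrow> bool \<Rightarrow> 'a set \<Rightarrow> bool"
  for E Q where
  finished: "(\<And>e. e \<in> E \<Longrightarrow> \<not> e \<subseteq> S) \<Longrightarrow> Q S \<Longrightarrow> can_force E Q t S"
| own_turn: "e \<in> E \<Longrightarrow> e \<subseteq> S \<Longrightarrow> can_force E Q False (S - e) \<Longrightarrow> can_force E Q True S"
| other_turn: "e\<^sub>0 \<in> E \<Longrightarrow> e\<^sub>0 \<subseteq> S \<Longrightarrow>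
    (\<And>e. e \<in> E \<Longrightarrow> e \<subseteq> S \<Longrightarrow> can_force E Q True (S - e)) \<Longrightarrow> can_force E Q False S"

text \<open>Rule \<open>own_turn\<close> with the remaining set as a separate variable, so that
  \<open>S - e\<close> can first be rewritten into the shape in which later lemmas describe
  \<open>T\<close>.\<close>

lemma can_force_move:
  assumes "S - e = T" and "can_force E Q False T" and "e \<in> E" and "e \<subseteq> S"
  shows "can_force E Q True S"
  using assms by (intro can_force.own_turn[of e]) simp_all

text \<open>Positions only shrink, so the two goals need comparing on subsets of \<open>S\<close>
  alone; this lets finiteness of \<open>S\<close> enter the comparison.\<close>

lemma can_force_mono:
  assumes "can_force E Q t S" and "\<And>T. T \<subseteq> S \<Longrightarrow> Q T \<Longrightarrow> Q' T"
  shows "can_force E Q' t S"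
  using assms
proof induction
  case (finished S t)
  then show ?case by (intro can_force.finished) auto
next
  case (own_turn e S)
  have "can_force E Q' False (S - e)"
    by (rule own_turn.IH, rule own_turn.prems) auto
  with own_turn.hyps(1,2) show ?case by (intro can_force.own_turn[of e])
next
  case (other_turn e\<^sub>0 S)
  have "can_force E Q' True (S - e)" if "e \<in> E" "e \<subseteq> S" for e
    by (rule other_turn.IH[OF that], rule other_turn.prems) auto
  with other_turn.hyps(1,2) show ?case by (intro can_force.other_turn[of e\<^sub>0])
qed

text \<open>For positions where play is irrelevant: if every move keeps \<open>I\<close> and every
  dead end with \<open>I\<close> satisfies \<open>Q\<close>, any sequence of moves succeeds, whoever
  is to move. Play ends because nonempty edges shrink the finite set.\<close>

lemma can_force_invariant:
  assumes "finite S" and "{} \<notin> E" and "I S"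
    and step: "\<And>T e. I T \<Longrightarrow> e \<in> E \<Longrightarrow> e \<subseteq> T \<Longrightarrow> I (T - e)"
    and final: "\<And>T. I T \<Longrightarrow> (\<And>e. e \<in> E \<Longrightarrow> \<not> e \<subseteq> T) \<Longrightarrow> Q T"
  shows "can_force E Q t S"
  using assms(1,3)
proof (induction S arbitrary: t rule: finite_psubset_induct)
  case (psubset S)
  show ?case
  proof (cases "\<exists>e\<in>E. e \<subseteq> S")
    case True
    have *: "can_force E Q t' (S - e)" if "e \<in> E" "e \<subseteq> S" for e t'
    proof -
      have "e \<noteq> {}" using \<open>e \<in> E\<close> \<open>{} \<notin> E\<close> by metis
      then show ?thesis
        using that psubset step by blast
    qed
    with True obtain e where "e \<in> E" "e \<subseteq> S" by auto
    then show ?thesis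
      by (cases t) (auto intro: can_force.own_turn can_force.other_turn *)
  next
    case False
    then have "Q S" using psubset.prems by (intro final) auto
    with False show ?thesis by (intro can_force.finished) auto
  qed
qed

section \<open>Minimax values from forcing strategies\<close>

text \<open>The moves depend on \<open>M\<close> only through the unmatched vertices, which
  justifies positions that are vertex sets. Nonemptiness of edges matters: a chosen empty edge would
  still fit into the unmatched set.\<close>

lemma legal_moves_induced:
  assumes "\<And>e. e \<in> E \<Longrightarrow> card e = 2" and "matching {e \<in> E. e \<subseteq> V} M"
  shows "legal_moves {e \<in> E. e \<subseteq> V} M = {e \<in> E. e \<subseteq> V - \<Union> M}"
proof -
  have ne: "e \<noteq> {}" if "e \<in> E" for e
    using assms(1)[OF that] by auto
  have "e \<notin> M \<and> matching {e \<in> E. e \<subseteq> V} (insert e M) \<longleftrightarrow> e \<subseteq> V - \<Union> M"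
    if e: "e \<in> E" for e
  proof
    assume *: "e \<notin> M \<and> matching {e \<in> E. e \<subseteq> V} (insert e M)"
    then have "e \<inter> f = {}" if "f \<in> M" for f
      using that by (auto simp: matching_def pairwise_insert disjnt_def)
    then show "e \<subseteq> V - \<Union> M"
      using * by (auto simp: matching_def)
  next
    assume *: "e \<subseteq> V - \<Union> M"
    then have "e \<notin> M" using ne[OF e] by auto
    then show "e \<notin> M \<and> matching {e \<in> E. e \<subseteq> V} (insert e M)"
      using * e assms(2) by (auto simp: matching_def pairwise_insert disjnt_def)
  qed
  then show ?thesis
    by (auto simp: legal_moves_def)
qed

lemma matching_insert_induced:
  assumes "matching {e \<in> E. e \<subseteq> V} M" and "e \<in> E" and "e \<subseteq> V - \<Union> M"
  shows "matching {e \<in> E. e \<subseteq> V} (insert e M)"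
  using assms by (auto simp: matching_def pairwise_insert disjnt_def)

text \<open>Translates the size of a matching into the number of unmatched vertices, the quantity
  that the strategies control.\<close>

lemma card_unmatched:
  assumes "finite V" and "\<And>e. e \<in> E \<Longrightarrow> card e = 2" and "matching {e \<in> E. e \<subseteq> V} M"
  shows "card V = 2 * card M + card (V - \<Union> M)"
proof -
  have M: "M \<subseteq> Pow V" "M \<subseteq> E" and disj: "pairwise disjnt M"
    using assms(3) by (auto simp: matching_def)
  have fin: "finite M" "\<Union> M \<subseteq> V"
    using M assms(1) by (auto intro: finite_subset)
  have "card (\<Union> M) = sum card M"
    using disj M assms(1) by (intro card_Union_disjoint) (auto intro: finite_subset)
  also have "\<dots> = 2 * card M"
    using M assms(2) by (simp add: subset_iff)
  finally show ?thesis
    using fin assms(1) card_Diff_subset[of "\<Union> M" V] card_mono[of V "\<Union> M"] finite_subset[of "\<Union> M" V]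
    by simp
qed

context
  fixes E :: "'a set set" and V :: "'a set"
  assumes finite_V: "finite V" and card_edge: "\<And>e. e \<in> E \<Longrightarrow> card e = 2"
begin

abbreviation (input) "EV \<equiv> {e \<in> E. e \<subseteq> V}"

lemma finite_EV: "finite EV"
  using finite_V by (auto intro: finite_subset[of _ "Pow V"])

lemma game_value_final:
  assumes "matching EV M" and "\<And>e. e \<in> E \<Longrightarrow> \<not> e \<subseteq> V - \<Union> M"
  shows "card V = 2 * game_value EV p M + card (V - \<Union> M)"
proof -
  have "legal_moves EV M = {}"
    using legal_moves_induced[OF card_edge assms(1)] assms(2) by auto
  then have "game_value EV p M = card M"
    by (subst game_value.simps) simp
  then show ?thesis
    using card_unmatched[OF finite_V card_edge assms(1)] by simp
qed

text \<open>The edge \<open>e\<^sub>0\<close> ensures that the maximum and minimum range over a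
  nonempty set.\<close>

lemma game_value_step:
  assumes "matching EV M" and "e\<^sub>0 \<in> E" and "e\<^sub>0 \<subseteq> V - \<Union> M"
  shows game_value_Maximizer:
      "game_value EV Maximizer M
        = (MAX e\<in>{e \<in> E. e \<subseteq> V - \<Union> M}. game_value EV Minimizer (insert e M))"
    and game_value_Minimizer:
      "game_value EV Minimizer M
        = (MIN e\<in>{e \<in> E. e \<subseteq> V - \<Union> M}. game_value EV Maximizer (insert e M))"
    and finite_moves: "finite {e \<in> E. e \<subseteq> V - \<Union> M}"
proof -
  have moves: "legal_moves EV M = {e \<in> E. e \<subseteq> V - \<Union> M}"
    using legal_moves_induced[OF card_edge assms(1)] .
  have ne: "legal_moves EV M \<noteq> {}"
    using assms(2,3) unfolding moves by blast
  show "game_value EV Maximizer M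
        = (MAX e\<in>{e \<in> E. e \<subseteq> V - \<Union> M}. game_value EV Minimizer (insert e M))"
    using ne finite_EV by (subst game_value.simps) (simp flip: moves)
  show "game_value EV Minimizer M
        = (MIN e\<in>{e \<in> E. e \<subseteq> V - \<Union> M}. game_value EV Maximizer (insert e M))"
    using ne finite_EV by (subst game_value.simps) (simp flip: moves)
  show "finite {e \<in> E. e \<subseteq> V - \<Union> M}"
    by (rule finite_subset[OF _ finite_EV]) auto
qed

text \<open>Here Max owns the strategy, so a true flag means that Max is to move. On Max's turn the
  value is at least that of the strategic move; on Min's turn the strategy covers every move.
  Writing the bound additively avoids halving and subtraction.\<close>

lemma game_value_ge:
  assumes "can_force E Q t S" and "\<And>T. Q T \<Longrightarrow> card T \<le> k"
    and "matching EV M" and "S = V - \<Union> M"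
  shows "card V \<le> 2 * game_value EV (if t then Maximizer else Minimizer) M + k"
  using assms(1,3,4)
proof (induction arbitrary: M)
  case (finished S t)
  then have "card V = 2 * game_value EV (if t then Maximizer else Minimizer) M + card S"
    using game_value_final by auto
  with assms(2)[OF finished.hyps(2)] show ?case by linarith
next
  case (own_turn e S)
  note hyp = own_turn.prems(1) own_turn.hyps(1) own_turn.hyps(2)[unfolded own_turn.prems(2)]
  have "S - e = V - \<Union> (insert e M)" using own_turn.prems(2) by auto
  from own_turn.IH[OF matching_insert_induced[OF hyp] this]
  have "card V \<le> 2 * game_value EV Minimizer (insert e M) + k" by simp
  moreover have "game_value EV Minimizer (insert e M) \<le> game_value EV Maximizer M"
    unfolding game_value_Maximizer[OF hyp] using hyp finite_moves[OF hyp] by (intro Max_ge) auto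
  ultimately show ?case by simp
next
  case (other_turn e\<^sub>0 S)
  let ?A = "{e \<in> E. e \<subseteq> V - \<Union> M}"
  note hyp = other_turn.prems(1) other_turn.hyps(1) other_turn.hyps(2)[unfolded other_turn.prems(2)]
  \<comment> \<open>The minimum is attained at some legal move, and the induction hypothesis holds
    for every legal move.\<close>
  have "game_value EV Minimizer M \<in> (\<lambda>e. game_value EV Maximizer (insert e M)) ` ?A"
    unfolding game_value_Minimizer[OF hyp] using hyp finite_moves[OF hyp] by (intro Min_in) auto
  then obtain e where e: "e \<in> ?A" and v: "game_value EV Minimizer M = game_value EV Maximizer (insert e M)"
    by auto
  have "S - e = V - \<Union> (insert e M)" using other_turn.prems(2) by auto
  from other_turn.IH[OF _ _ matching_insert_induced[OF hyp(1)] this] e other_turn.prems(2) v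
  show ?case by simp
qed

text \<open>Dual to \<open>game_value_ge\<close>: Min owns the strategy, so the flag is read the
  other way round and \<open>k\<close> bounds the unmatched vertices from below.\<close>

lemma game_value_le:
  assumes "can_force E Q t S" and "\<And>T. Q T \<Longrightarrow> k \<le> card T"
    and "matching EV M" and "S = V - \<Union> M"
  shows "2 * game_value EV (if t then Minimizer else Maximizer) M + k \<le> card V"
  using assms(1,3,4)
proof (induction arbitrary: M)
  case (finished S t)
  then have "card V = 2 * game_value EV (if t then Minimizer else Maximizer) M + card S"
    using game_value_final by auto
  with assms(2)[OF finished.hyps(2)] show ?case by linarith
next
  case (own_turn e S)
  note hyp = own_turn.prems(1) own_turn.hyps(1) own_turn.hyps(2)[unfolded own_turn.prems(2)]
  have "S - e = V - \<Union> (insert e M)" using own_turn.prems(2) by auto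
  from own_turn.IH[OF matching_insert_induced[OF hyp] this]
  have "2 * game_value EV Maximizer (insert e M) + k \<le> card V" by simp
  moreover have "game_value EV Minimizer M \<le> game_value EV Maximizer (insert e M)"
    unfolding game_value_Minimizer[OF hyp] using hyp finite_moves[OF hyp] by (intro Min_le) auto
  ultimately show ?case by simp
next
  case (other_turn e\<^sub>0 S)
  let ?A = "{e \<in> E. e \<subseteq> V - \<Union> M}"
  note hyp = other_turn.prems(1) other_turn.hyps(1) other_turn.hyps(2)[unfolded other_turn.prems(2)]
  have "game_value EV Maximizer M \<in> (\<lambda>e. game_value EV Minimizer (insert e M)) ` ?A"
    unfolding game_value_Maximizer[OF hyp] using hyp finite_moves[OF hyp] by (intro Max_in) auto
  then obtain e where e: "e \<in> ?A" and v: "game_value EV Maximizer M = game_value EV Minimizer (insert e M)"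
    by auto
  have "S - e = V - \<Union> (insert e M)" using other_turn.prems(2) by auto
  from other_turn.IH[OF _ _ matching_insert_induced[OF hyp(1)] this] e other_turn.prems(2) v
  show ?case by simp
qed

end

section \<open>Two linked cliques\<close>

text \<open>Around the cycle \<open>a, b, c, d\<close> links and missing edges alternate:
  \<open>{a, b}\<close> and \<open>{c, d}\<close> are links, \<open>{b, c}\<close> and
  \<open>{d, a}\<close> are missing.\<close>

definition linked_edges :: "'a set \<Rightarrow> 'a set \<Rightarrow> 'a \<Rightarrow> 'a \<Rightarrow> 'a \<Rightarrow> 'a \<Rightarrow> 'a set set" where
  "linked_edges P Q a b c d = {e. card e = 2 \<and>
    (e \<subseteq> {a, d} \<union> P \<and> e \<noteq> {a, d} \<or> e \<subseteq> {b, c} \<union> Q \<and> e \<noteq> {b, c} \<or> e = {a, b} \<or> e = {c, d})}"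

text \<open>This reflection of the cycle \<open>a, b, c, d\<close> and the one in
  \<open>linked_edges_swap_links\<close> generate the symmetries that later reduce eight kinds of
  first move to three.\<close>

lemma linked_edges_swap_sides: "linked_edges Q P b a d c = linked_edges P Q a b c d"
  unfolding linked_edges_def by (auto simp: insert_commute)

lemma linked_edges_swap_links: "linked_edges P Q d c b a = linked_edges P Q a b c d"
  unfolding linked_edges_def by (auto simp: insert_commute)

locale linked_cliques =
  fixes P Q :: "'a set" and a b c d :: 'a
  assumes finite_P: "finite P" and finite_Q: "finite Q" and disjoint: "P \<inter> Q = {}"
    and distinct: "distinct [a, b, c, d]" and hubs: "{a, b, c, d} \<inter> (P \<union> Q) = {}"
begin

abbreviation "E \<equiv> linked_edges P Q a b c d"

lemma card_edge: "e \<in> E \<Longrightarrow> card e = 2"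
  by (simp add: linked_edges_def)

lemma empty_not_edge: "{} \<notin> E"
  using card_edge[of "{}"] by auto

lemma swap_sides: "linked_cliques Q P b a d c"
  using finite_P finite_Q disjoint distinct hubs by unfold_locales auto

lemma swap_links: "linked_cliques P Q d c b a"
  using finite_P finite_Q disjoint distinct hubs by unfold_locales auto

lemma edges [simp]:
  "x \<in> P \<Longrightarrow> y \<in> P \<Longrightarrow> x \<noteq> y \<Longrightarrow> {x, y} \<in> E"
  "x \<in> P \<Longrightarrow> {x, a} \<in> E" "x \<in> P \<Longrightarrow> {x, d} \<in> E"
  "x \<in> Q \<Longrightarrow> y \<in> Q \<Longrightarrow> x \<noteq> y \<Longrightarrow> {x, y} \<in> E"
  "x \<in> Q \<Longrightarrow> {x, b} \<in> E" "x \<in> Q \<Longrightarrow> {x, c} \<in> E"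
  "{a, b} \<in> E" "{c, d} \<in> E"
  using distinct hubs by (auto simp: linked_edges_def doubleton_eq_iff card_2_iff)

lemma edge_cases:
  assumes "e \<in> E"
  obtains (PP) x y where "x \<in> P" "y \<in> P" "x \<noteq> y" "e = {x, y}"
  | (Pa) x where "x \<in> P" "e = {x, a}"
  | (Pd) x where "x \<in> P" "e = {x, d}"
  | (QQ) x y where "x \<in> Q" "y \<in> Q" "x \<noteq> y" "e = {x, y}"
  | (Qb) x where "x \<in> Q" "e = {x, b}"
  | (Qc) x where "x \<in> Q" "e = {x, c}"
  | (ab) "e = {a, b}"
  | (cd) "e = {c, d}"
proof -
  from card_edge[OF assms] obtain x y where e: "e = {x, y}" "x \<noteq> y"
    by (auto simp: card_2_iff)
  have sym: "e = {y, x}"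
    using e by auto
  consider "{x, y} \<subseteq> {a, d} \<union> P" "{x, y} \<noteq> {a, d}"
    | "{x, y} \<subseteq> {b, c} \<union> Q" "{x, y} \<noteq> {b, c}" | "e = {a, b}" | "e = {c, d}"
    using assms e by (auto simp: linked_edges_def)
  then show ?thesis
  proof cases
    case 1
    then consider "x \<in> P" "y \<in> P" | "x \<in> P" "y = a" | "x \<in> P" "y = d" | "y \<in> P" "x = a" | "y \<in> P" "x = d"
      using e by auto
    then show ?thesis
      using PP[OF _ _ e(2,1)] Pa[of x] Pd[of x] Pa[of y] Pd[of y] e(1) sym by cases (simp, metis+)
  next
    case 2
    then consider "x \<in> Q" "y \<in> Q" | "x \<in> Q" "y = b" | "x \<in> Q" "y = c" | "y \<in> Q" "x = b" | "y \<in> Q" "x = c"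
      using e by auto
    then show ?thesis
      using QQ[OF _ _ e(2,1)] Qb[of x] Qc[of x] Qb[of y] Qc[of y] e(1) sym by cases (simp, metis+)
  next
    case 3
    then show ?thesis by (rule ab)
  next
    case 4
    then show ?thesis by (rule cd)
  qed
qed

section \<open>Settled positions\<close>

text \<open>The unmatched vertices form two unlinked complete graphs whose orders have equal parity,
  even iff \<open>parity\<close>. The flag lets one argument serve Max, who aims at
  \<open>True\<close>, and Min, who aims at \<open>False\<close>.\<close>

definition settled :: "bool \<Rightarrow> 'a set \<Rightarrow> bool" where
  "settled parity S \<longleftrightarrow> S \<subseteq> P \<union> Q \<union> {a, b, c, d} \<and>
    \<not> {a, b} \<subseteq> S \<and> \<not> {c, d} \<subseteq> S \<and> \<not> {a, d} \<subseteq> S \<and> \<not> {b, c} \<subseteq> S \<and>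
    even (card (S \<inter> ({a, d} \<union> P))) = parity \<and> even (card (S \<inter> ({b, c} \<union> Q))) = parity"

text \<open>Each move removes two vertices of one side, so both parities are invariant. At the end
  each complete side holds at most one vertex: none if even, one if odd.\<close>

lemma can_force_settled:
  assumes "settled parity S"
  shows "can_force E (\<lambda>T. T = {} \<longleftrightarrow> parity) t S"
proof (rule can_force_invariant[where I = "settled parity"])
  show "finite S"
    using assms finite_P finite_Q by (auto simp: settled_def intro: finite_subset)
  show "settled parity (T - e)" if T: "settled parity T" and e: "e \<in> E" "e \<subseteq> T" for T e
  proof -
    let ?L = "{a, d} \<union> P" and ?R = "{b, c} \<union> Q"
    have "?L \<inter> ?R = {}" using disjoint distinct hubs by auto
    \<comment> \<open>Neither link lies in \<open>T\<close>, so no available edge crosses between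
      the sides.\<close>
    moreover have "e \<subseteq> ?L \<or> e \<subseteq> ?R"
      using e T by (auto simp: settled_def linked_edges_def)
    moreover have parity: "even (card ((T - e) \<inter> X)) = even (card (T \<inter> X))" if "e \<subseteq> X \<or> e \<inter> X = {}" for X
    proof (cases "e \<subseteq> X")
      case True
      have *: "(T - e) \<inter> X = T \<inter> X - e" by auto
      have "finite e" using card_edge[OF e(1)] by (auto intro: card_ge_0_finite)
      moreover have "finite (T \<inter> X)"
        using T finite_P finite_Q by (auto simp: settled_def intro: finite_subset)
      ultimately show ?thesis
        using True e card_edge[OF e(1)] card_mono[of "T \<inter> X" e]
        unfolding * by (subst card_Diff_subset) auto
    next
      case False
      then have "(T - e) \<inter> X = T \<inter> X" using that by auto
      then show ?thesis by simp
    qed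
    ultimately have "even (card ((T - e) \<inter> ?L)) = even (card (T \<inter> ?L))"
      "even (card ((T - e) \<inter> ?R)) = even (card (T \<inter> ?R))"
      by (intro parity; blast)+
    then show ?thesis
      using T by (auto simp: settled_def)
  qed
  show "T = {} \<longleftrightarrow> parity" if T: "settled parity T" and final: "\<And>e. e \<in> E \<Longrightarrow> \<not> e \<subseteq> T" for T
  proof -
    let ?L = "{a, d} \<union> P" and ?R = "{b, c} \<union> Q"
    have small: "card (T \<inter> X) \<le> 1"
      if "\<And>x y. x \<in> T \<inter> X \<Longrightarrow> y \<in> T \<inter> X \<Longrightarrow> x \<noteq> y \<Longrightarrow> {x, y} \<in> E" for X
    proof (rule ccontr)
      assume "\<not> card (T \<inter> X) \<le> 1"
      then have "2 \<le> card (T \<inter> X)" by simp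
      then obtain B where "B \<subseteq> T \<inter> X" "card B = 2"
        by (meson obtain_subset_with_card_n)
      then obtain x y where "x \<in> T \<inter> X" "y \<in> T \<inter> X" "x \<noteq> y"
        by (auto simp: card_2_iff)
      then show False
        using that[of x y] final[of "{x, y}"] by auto
    qed
    \<comment> \<open>Neither missing edge lies in \<open>T\<close>, so two vertices of
      \<open>T\<close> on the same side are always adjacent.\<close>
    have "card (T \<inter> ?L) \<le> 1" "card (T \<inter> ?R) \<le> 1"
      using T by (intro small; auto simp: settled_def linked_edges_def doubleton_eq_iff card_2_iff)+
    moreover have "finite T"
      using T finite_P finite_Q by (auto simp: settled_def intro: finite_subset)
    moreover have "T = (T \<inter> ?L) \<union> (T \<inter> ?R)"
      using T by (auto simp: settled_def)
    ultimately show ?thesis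
      using T unfolding settled_def
      by (metis Un_empty card.empty card_eq_0_iff even_zero finite_Int le_antisym less_one linorder_not_le odd_one)
  qed
qed (use assms empty_not_edge in auto)

lemma card_hubs:
  assumes "X \<subseteq> P" and "Y \<subseteq> Q"
  shows "card (X \<union> Y) = card X + card Y"
    and "card (X \<union> Y \<union> {c, d}) = card X + card Y + 2"
    and "card (X \<union> Y \<union> {a, b, c, d}) = card X + card Y + 4"
proof -
  have fin: "finite X" "finite Y"
    using assms finite_P finite_Q by (auto intro: finite_subset)
  have "X \<inter> Y = {}"
    using assms disjoint by auto
  with fin show *: "card (X \<union> Y) = card X + card Y"
    by (rule card_Un_disjoint)
  have "a \<notin> X \<union> Y" "b \<notin> X \<union> Y" "c \<notin> X \<union> Y" "d \<notin> X \<union> Y"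
    using assms hubs by auto
  then show "card (X \<union> Y \<union> {c, d}) = card X + card Y + 2"
    "card (X \<union> Y \<union> {a, b, c, d}) = card X + card Y + 4"
    using fin distinct * by simp_all
qed

text \<open>The shapes left behind by the answers in \<open>reply_ab\<close> and
  \<open>reply_Pa\<close>; each \<open>Suc\<close> counts the hub remaining on that side.\<close>

lemma settledI:
  assumes "X \<subseteq> P" and "Y \<subseteq> Q"
  shows settled_no_hub: "even (card X) = parity \<Longrightarrow> even (card Y) = parity \<Longrightarrow> settled parity (X \<union> Y)"
    and settled_b: "even (card X) = parity \<Longrightarrow> even (Suc (card Y)) = parity \<Longrightarrow> settled parity (X \<union> Y \<union> {b})"
    and settled_c: "even (card X) = parity \<Longrightarrow> even (Suc (card Y)) = parity \<Longrightarrow> settled parity (X \<union> Y \<union> {c})"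
    and settled_bd: "even (Suc (card X)) = parity \<Longrightarrow> even (Suc (card Y)) = parity \<Longrightarrow> settled parity (X \<union> Y \<union> {b, d})"
proof -
  have fin: "finite X" "finite Y"
    using assms finite_P finite_Q by (auto intro: finite_subset)
  have out: "a \<notin> X \<union> Y" "b \<notin> X \<union> Y" "c \<notin> X \<union> Y" "d \<notin> X \<union> Y"
    using assms hubs by auto
  have hubs': "a \<notin> P \<union> Q" "b \<notin> P \<union> Q" "c \<notin> P \<union> Q" "d \<notin> P \<union> Q"
    using hubs by auto
  have "(X \<union> Y) \<inter> ({a, d} \<union> P) = X" "(X \<union> Y) \<inter> ({b, c} \<union> Q) = Y"
    using assms disjoint out by auto
  then show "settled parity (X \<union> Y)" if "even (card X) = parity" "even (card Y) = parity"
    using that assms out by (auto simp: settled_def)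
  have "(X \<union> Y \<union> {b}) \<inter> ({a, d} \<union> P) = X" "(X \<union> Y \<union> {b}) \<inter> ({b, c} \<union> Q) = insert b Y"
    using assms disjoint out hubs' distinct by auto
  then show "settled parity (X \<union> Y \<union> {b})" if "even (card X) = parity" "even (Suc (card Y)) = parity"
    using that assms out fin distinct by (auto simp: settled_def)
  have "(X \<union> Y \<union> {c}) \<inter> ({a, d} \<union> P) = X" "(X \<union> Y \<union> {c}) \<inter> ({b, c} \<union> Q) = insert c Y"
    using assms disjoint out hubs' distinct by auto
  then show "settled parity (X \<union> Y \<union> {c})" if "even (card X) = parity" "even (Suc (card Y)) = parity"
    using that assms out fin distinct by (auto simp: settled_def)
  have "(X \<union> Y \<union> {b, d}) \<inter> ({a, d} \<union> P) = insert d X"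
    "(X \<union> Y \<union> {b, d}) \<inter> ({b, c} \<union> Q) = insert b Y"
    using assms disjoint out hubs' distinct by auto
  then show "settled parity (X \<union> Y \<union> {b, d})"
    if "even (Suc (card X)) = parity" "even (Suc (card Y)) = parity"
    using that assms out fin distinct by (auto simp: settled_def)
qed

section \<open>Answers of the controlling player\<close>

text \<open>Taking \<open>{c, d}\<close> leaves sides of order \<open>card X\<close>; taking
  \<open>{x, d}\<close> leaves orders \<open>card X - 1\<close> and \<open>card Y + 1\<close>, of
  the opposite parity. If \<open>X\<close> is empty only \<open>{c, d}\<close> remains, which leads
  to a perfect matching.\<close>

lemma reply_ab:
  assumes sub: "X \<subseteq> P" "Y \<subseteq> Q" and card: "card X = card Y" and ne: "parity \<or> X \<noteq> {}"
  shows "can_force E (\<lambda>T. T = {} \<longleftrightarrow> parity) True (X \<union> Y \<union> {c, d})"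
proof (cases "even (card X) = parity")
  case True
  have "X \<union> Y \<union> {c, d} - {c, d} = X \<union> Y"
    using sub hubs by auto
  moreover have "settled parity (X \<union> Y)"
    using True card by (intro settled_no_hub sub) simp_all
  ultimately show ?thesis
    by (rule can_force_move[OF _ can_force_settled]) (use sub in auto)
next
  case False
  have "finite X" using sub finite_P by (auto intro: finite_subset)
  obtain x where x: "x \<in> X"
    using ne False by (cases "X = {}") auto
  have "X \<union> Y \<union> {c, d} - {x, d} = (X - {x}) \<union> Y \<union> {c}"
    using sub hubs disjoint distinct x by auto
  moreover have "settled parity ((X - {x}) \<union> Y \<union> {c})"
  proof (intro settled_c)
    have "card X = Suc (card (X - {x}))"
      using \<open>finite X\<close> x by (simp only: card.remove)
    then show "even (card (X - {x})) = parity" "even (Suc (card Y)) = parity"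
      using False card by auto
  qed (use sub in auto)
  ultimately show ?thesis
    by (rule can_force_move[OF _ can_force_settled]) (use x sub in auto)
qed

text \<open>Taking \<open>{c, d}\<close> leaves orders \<open>card X\<close> and
  \<open>card X + 2\<close>; taking \<open>{y, c}\<close> leaves \<open>card X + 1\<close> on both
  sides. Since \<open>Y\<close> is nonempty, both answers are always available.\<close>

lemma reply_Pa:
  assumes sub: "X \<subseteq> P" "Y \<subseteq> Q" and card: "card Y = Suc (card X)"
  shows "can_force E (\<lambda>T. T = {} \<longleftrightarrow> parity) True (X \<union> Y \<union> {b, c, d})"
proof (cases "even (card X) = parity")
  case True
  have "X \<union> Y \<union> {b, c, d} - {c, d} = X \<union> Y \<union> {b}"
    using sub hubs distinct by auto
  moreover have "settled parity (X \<union> Y \<union> {b})"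
    using True card by (intro settled_b sub) simp_all
  ultimately show ?thesis
    by (rule can_force_move[OF _ can_force_settled]) (use sub in auto)
next
  case False
  obtain y where y: "y \<in> Y"
    using card by fastforce
  have "X \<union> Y \<union> {b, c, d} - {y, c} = X \<union> (Y - {y}) \<union> {b, d}"
    using sub hubs disjoint distinct y by auto
  moreover have "settled parity (X \<union> (Y - {y}) \<union> {b, d})"
    using False card y sub by (intro settled_bd) auto
  ultimately show ?thesis
    by (rule can_force_move[OF _ can_force_settled]) (use y sub in auto)
qed

text \<open>All neighbours of \<open>a\<close> lie in \<open>P\<close> or equal \<open>b\<close>.
  Once these are gone, \<open>a\<close> stays unmatched to the end.\<close>

lemma can_force_isolated:
  assumes "Y \<subseteq> Q"
  shows "can_force E (\<lambda>T. T = {} \<longleftrightarrow> False) t (Y \<union> {a, c, d})"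
proof (rule can_force_invariant[where I = "\<lambda>T. a \<in> T \<and> b \<notin> T \<and> T \<inter> P = {}"])
  show "finite (Y \<union> {a, c, d})"
    using assms finite_Q by (auto intro: finite_subset)
  show "a \<in> Y \<union> {a, c, d} \<and> b \<notin> Y \<union> {a, c, d} \<and> (Y \<union> {a, c, d}) \<inter> P = {}"
    using assms hubs disjoint distinct by auto
  show "a \<in> T - e \<and> b \<notin> T - e \<and> (T - e) \<inter> P = {}"
    if "a \<in> T \<and> b \<notin> T \<and> T \<inter> P = {}" "e \<in> E" "e \<subseteq> T" for T e
    using that(2)
  proof (cases rule: edge_cases)
    case cd
    then show ?thesis using that distinct by auto
  qed (use that hubs distinct in auto)
  show "T = {} \<longleftrightarrow> False" if "a \<in> T \<and> b \<notin> T \<and> T \<inter> P = {}" for T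
    using that by auto
qed (rule empty_not_edge)

text \<open>If a single pair is left on the far side, answering with it would leave only the edges
  \<open>{a, b}\<close> and \<open>{c, d}\<close>, hence a perfect matching. To avoid one, isolate \<open>a\<close> instead.\<close>

lemma reply_PP:
  assumes sub: "X \<subseteq> P" "Y \<subseteq> Q" and card: "card Y = card X + 2"
    and IH: "\<And>Y'. Y' \<subseteq> Q \<Longrightarrow> card Y' = card X \<Longrightarrow> parity \<or> X \<noteq> {} \<Longrightarrow>
      can_force E (\<lambda>T. T = {} \<longleftrightarrow> parity) False (X \<union> Y' \<union> {a, b, c, d})"
  shows "can_force E (\<lambda>T. T = {} \<longleftrightarrow> parity) True (X \<union> Y \<union> {a, b, c, d})"
proof -
  have "2 \<le> card Y" using card by simp
  then obtain B where "B \<subseteq> Y" "card B = 2"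
    by (meson obtain_subset_with_card_n)
  then obtain y z where yz: "y \<in> Y" "z \<in> Y" "y \<noteq> z"
    by (auto simp: card_2_iff)
  have edge: "{y, z} \<in> E"
    using yz sub by (intro edges(4)) auto
  show ?thesis
  proof (cases "parity \<or> X \<noteq> {}")
    case True
    have "X \<union> Y \<union> {a, b, c, d} - {y, z} = X \<union> (Y - {y, z}) \<union> {a, b, c, d}"
      using yz sub hubs disjoint by auto
    moreover have "card (Y - {y, z}) = card X"
      using yz card by (simp add: card_Diff_subset)
    then have "can_force E (\<lambda>T. T = {} \<longleftrightarrow> parity) False (X \<union> (Y - {y, z}) \<union> {a, b, c, d})"
      using True sub by (intro IH) auto
    ultimately show ?thesis
      by (rule can_force_move) (use yz sub edge in auto)
  next
    case False
    \<comment> \<open>With \<open>X\<close> empty, \<open>b\<close> is the only remaining neighbour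
      of \<open>a\<close>; matching it to \<open>y\<close> strands \<open>a\<close>.\<close>
    have "X \<union> Y \<union> {a, b, c, d} - {y, b} = (Y - {y}) \<union> {a, c, d}"
      using False yz sub hubs distinct by auto
    moreover have "can_force E (\<lambda>T. T = {} \<longleftrightarrow> parity) False ((Y - {y}) \<union> {a, c, d})"
      using False can_force_isolated[of "Y - {y}"] sub by auto
    ultimately show ?thesis
      by (rule can_force_move) (use yz sub in auto)
  qed
qed

text \<open>Mirroring keeps \<open>card X = card Y\<close>, and the induction runs until a hub is
  used. For \<open>X = {}\<close> only the two links are left, so an imperfect outcome cannot be
  forced there.\<close>

lemma can_force_second:
  assumes "X \<subseteq> P" and "Y \<subseteq> Q" and "card X = card Y" and "parity \<or> X \<noteq> {}"
  shows "can_force E (\<lambda>T. T = {} \<longleftrightarrow> parity) False (X \<union> Y \<union> {a, b, c, d})"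
  using assms
proof (induction "card X" arbitrary: X Y rule: less_induct)
  case less
  \<comment> \<open>The three nontrivial symmetric images of the configuration; the equations
    \<open>E\<close> identify their edge families with the original one.\<close>
  interpret sides: linked_cliques Q P b a d c by (rule swap_sides)
  interpret links: linked_cliques P Q d c b a by (rule swap_links)
  interpret both: linked_cliques Q P c d a b by (rule links.swap_sides)
  have E: "linked_edges Q P b a d c = E" "linked_edges P Q d c b a = E" "linked_edges Q P c d a b = E"
    by (simp_all add: linked_edges_swap_sides linked_edges_swap_links[of P Q])
  note sub = less.prems(1,2) and card = less.prems(3)
  have fin: "finite X" "finite Y"
    using sub finite_P finite_Q by (auto intro: finite_subset)
  let ?F = "can_force E (\<lambda>T. T = {} \<longleftrightarrow> parity)"
  let ?S = "X \<union> Y \<union> {a, b, c, d}"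
  show ?case
  \<comment> \<open>The edge \<open>{a, b}\<close> only witnesses that the game is not over.\<close>
  proof (rule can_force.other_turn[of "{a, b}"])
    fix e assume e: "e \<in> E" "e \<subseteq> ?S"
    have ne: "parity \<or> Y \<noteq> {}"
      using less.prems(4) card fin by auto
    have out: "a \<notin> P \<union> Q" "b \<notin> P \<union> Q" "c \<notin> P \<union> Q" "d \<notin> P \<union> Q"
      using hubs by auto
    show "?F True (?S - e)"
      using e(1)
    proof (cases rule: edge_cases)
      case (PP x y)
      then have xy: "x \<in> X" "y \<in> X"
        using e out disjoint sub by auto
      have card': "card X = card (X - {x, y}) + 2"
        using xy PP fin card_Diff_subset[of "{x, y}" X] card_mono[of X "{x, y}"] by simp
      have "?F True ((X - {x, y}) \<union> Y \<union> {a, b, c, d})"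
      proof (rule reply_PP)
        show "?F False ((X - {x, y}) \<union> Y' \<union> {a, b, c, d})"
          if "Y' \<subseteq> Q" "card Y' = card (X - {x, y})" "parity \<or> X - {x, y} \<noteq> {}" for Y'
          using that sub card' by (intro less.hyps) auto
      qed (use sub card card' in auto)
      moreover have "?S - e = (X - {x, y}) \<union> Y \<union> {a, b, c, d}"
        using PP out disjoint sub xy by auto
      ultimately show ?thesis by simp
    next
      case (QQ x y)
      then have xy: "x \<in> Y" "y \<in> Y"
        using e out disjoint sub by auto
      have card': "card Y = card (Y - {x, y}) + 2"
        using xy QQ fin card_Diff_subset[of "{x, y}" Y] card_mono[of Y "{x, y}"] by simp
      have "?F True ((Y - {x, y}) \<union> X \<union> {b, a, d, c})"
      \<comment> \<open>Because \<open>reply_PP\<close> takes the induction hypothesis as a premise,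
        it can be reused with the sides exchanged.\<close>
      proof (rule sides.reply_PP[unfolded E])
        show "?F False ((Y - {x, y}) \<union> X' \<union> {b, a, d, c})"
          if X': "X' \<subseteq> P" "card X' = card (Y - {x, y})" "parity \<or> Y - {x, y} \<noteq> {}" for X'
        proof -
          have "parity \<or> X' \<noteq> {}"
            using X' fin by auto
          then have "?F False (X' \<union> (Y - {x, y}) \<union> {a, b, c, d})"
            using X' sub card card' by (intro less.hyps) auto
          then show ?thesis
            by (simp add: Un_commute insert_commute)
        qed
      qed (use sub card card' in auto)
      moreover have "?S - e = (Y - {x, y}) \<union> X \<union> {b, a, d, c}"
        using QQ out disjoint sub xy by auto
      ultimately show ?thesis by simp
    next
      case (Pa x)
      then have x: "x \<in> X" using e out disjoint sub by auto
      have "?S - e = (X - {x}) \<union> Y \<union> {b, c, d}"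
        using Pa out disjoint sub x distinct by auto
      moreover have "?F True ((X - {x}) \<union> Y \<union> {b, c, d})"
        using sub card card_Suc_Diff1[OF fin(1) x] by (intro reply_Pa) auto
      ultimately show ?thesis by simp
    next
      case (Pd x)
      then have x: "x \<in> X" using e out disjoint sub by auto
      have "?S - e = (X - {x}) \<union> Y \<union> {c, b, a}"
        using Pd out disjoint sub x distinct by auto
      moreover have "?F True ((X - {x}) \<union> Y \<union> {c, b, a})"
        using sub card card_Suc_Diff1[OF fin(1) x] by (intro links.reply_Pa[unfolded E]) auto
      ultimately show ?thesis by simp
    next
      case (Qb x)
      then have x: "x \<in> Y" using e out disjoint sub by auto
      have "?S - e = (Y - {x}) \<union> X \<union> {a, d, c}"
        using Qb out disjoint sub x distinct by auto
      moreover have "?F True ((Y - {x}) \<union> X \<union> {a, d, c})"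
        using sub card card_Suc_Diff1[OF fin(2) x] by (intro sides.reply_Pa[unfolded E]) auto
      ultimately show ?thesis by simp
    next
      case (Qc x)
      then have x: "x \<in> Y" using e out disjoint sub by auto
      have "?S - e = (Y - {x}) \<union> X \<union> {d, a, b}"
        using Qc out disjoint sub x distinct by auto
      moreover have "?F True ((Y - {x}) \<union> X \<union> {d, a, b})"
        using sub card card_Suc_Diff1[OF fin(2) x] by (intro both.reply_Pa[unfolded E]) auto
      ultimately show ?thesis by simp
    next
      case ab
      have "?S - e = X \<union> Y \<union> {c, d}"
        using ab out sub distinct by auto
      then show ?thesis
        using reply_ab[OF less.prems] by simp
    next
      case cd
      have "?S - e = X \<union> Y \<union> {b, a}"
        using cd out sub distinct by auto
      then show ?thesis
        using links.reply_ab[unfolded E, OF less.prems] by simp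
    qed
  qed auto
qed

section \<open>Final positions and game values\<close>

text \<open>A side that still has a clique vertex holds nothing else, and otherwise holds at most
  its two hubs; the links exclude all four hubs together. Three is attained, for instance by
  \<open>a\<close>, \<open>d\<close> and a vertex of \<open>Q\<close>.\<close>

lemma card_final:
  assumes "S \<subseteq> P \<union> Q \<union> {a, b, c, d}" and "\<And>e. e \<in> E \<Longrightarrow> \<not> e \<subseteq> S"
  shows "card S \<le> 3"
proof -
  have no: "\<not> (x \<in> S \<and> y \<in> S)" if "{x, y} \<in> E" for x y
    using assms(2)[OF that] by simp
  have L: "S \<inter> ({a, d} \<union> P) \<subseteq> {a, d} \<or> (\<exists>x. S \<inter> ({a, d} \<union> P) \<subseteq> {x})"
  proof (cases "S \<inter> P = {}")
    case False
    then obtain x where "x \<in> S" "x \<in> P" by auto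
    then have "S \<inter> ({a, d} \<union> P) \<subseteq> {x}"
      using no[of x a] no[of x d] no[OF edges(1)[of x]] by auto
    then show ?thesis by blast
  qed auto
  have R: "S \<inter> ({b, c} \<union> Q) \<subseteq> {b, c} \<or> (\<exists>x. S \<inter> ({b, c} \<union> Q) \<subseteq> {x})"
  proof (cases "S \<inter> Q = {}")
    case False
    then obtain x where "x \<in> S" "x \<in> Q" by auto
    then have "S \<inter> ({b, c} \<union> Q) \<subseteq> {x}"
      using no[of x b] no[of x c] no[OF edges(4)[of x]] by auto
    then show ?thesis by blast
  qed auto
  have S: "S = S \<inter> ({a, d} \<union> P) \<union> S \<inter> ({b, c} \<union> Q)"
    using assms(1) by auto
  have ab: "a \<notin> S \<or> b \<notin> S" and cd: "c \<notin> S \<or> d \<notin> S"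
    using no[of a b] no[of c d] by auto
  have le: "card S \<le> card B" if "S \<subseteq> B" "finite B" for B
    using that by (simp add: card_mono)
  have three: "card {x, y, z} \<le> 3" for x y z :: 'a
    by (simp add: card_insert_if)
  from L R show ?thesis
  proof (elim disjE exE)
    assume "S \<inter> ({a, d} \<union> P) \<subseteq> {a, d}" "S \<inter> ({b, c} \<union> Q) \<subseteq> {b, c}"
    then have "S \<subseteq> {a, d, b, c}" using S by auto
    then have "S \<subseteq> {a, d, c} \<or> S \<subseteq> {d, b, c}" using ab by auto
    then show ?thesis
      using le three by (meson finite.emptyI finite.insertI order_trans)
  next
    fix x assume "S \<inter> ({a, d} \<union> P) \<subseteq> {a, d}" "S \<inter> ({b, c} \<union> Q) \<subseteq> {x}"
    then have "S \<subseteq> {a, d, x}" using S by auto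
    then show ?thesis
      using le three by (meson finite.emptyI finite.insertI order_trans)
  next
    fix x assume "S \<inter> ({a, d} \<union> P) \<subseteq> {x}" "S \<inter> ({b, c} \<union> Q) \<subseteq> {b, c}"
    then have "S \<subseteq> {x, b, c}" using S by auto
    then show ?thesis
      using le three by (meson finite.emptyI finite.insertI order_trans)
  next
    fix x y assume "S \<inter> ({a, d} \<union> P) \<subseteq> {x}" "S \<inter> ({b, c} \<union> Q) \<subseteq> {y}"
    \<comment> \<open>Repeating \<open>y\<close> brings the set into the three-element form covered
      by \<open>three\<close>.\<close>
    then have "S \<subseteq> {x, y, y}" using S by auto
    then show ?thesis
      using le three by (meson finite.emptyI finite.insertI order_trans)
  qed
qed

context
  fixes V :: "'a set" and n :: nat
  assumes sub: "V \<subseteq> P \<union> Q \<union> {a, b, c, d}" and card_V: "card V = 2 * n"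
begin

lemma finite_V: "finite V"
  using sub finite_P finite_Q by (auto intro: finite_subset)

text \<open>An even number of vertices, at most three, stays unmatched, hence none or two. So the
  value is \<open>n\<close> or \<open>n - 1\<close>, and only perfection of the matching is at
  stake.\<close>

lemma value_bounds:
  "n \<le> game_value {e \<in> E. e \<subseteq> V} p {} + 1" "game_value {e \<in> E. e \<subseteq> V} p {} \<le> n"
proof -
  have M: "matching {e \<in> E. e \<subseteq> V} {}" "V = V - \<Union> {}"
    by (auto simp: matching_def)
  have "can_force E (\<lambda>T. card T \<le> 2) t V" for t
  proof (rule can_force_invariant[where I = "\<lambda>T. T \<subseteq> V \<and> even (card T)"])
    show "T - e \<subseteq> V \<and> even (card (T - e))" if "T \<subseteq> V \<and> even (card T)" "e \<in> E" "e \<subseteq> T" for T e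
    proof -
      have "finite e" "card e = 2"
        using card_edge[OF that(2)] by (auto intro: card_ge_0_finite)
      then show ?thesis
        using that card_Diff_subset[of e T] card_mono[of T e] finite_subset[OF _ finite_V, of T] by auto
    qed
    show "card T \<le> 2" if "T \<subseteq> V \<and> even (card T)" "\<And>e. e \<in> E \<Longrightarrow> \<not> e \<subseteq> T" for T
    proof -
      have "card T \<le> 3"
        using that sub by (intro card_final) blast+
      moreover have "card T \<noteq> 3"
        using that(1) by auto
      ultimately show ?thesis by simp
    qed
  qed (use finite_V empty_not_edge card_V in auto)
  \<comment> \<open>Choosing the flag as \<open>p = Maximizer\<close> makes the player to move equal
    to \<open>p\<close> in either case.\<close>
  from game_value_ge[OF finite_V card_edge this _ M, of 2 "p = Maximizer"]
  show "n \<le> game_value {e \<in> E. e \<subseteq> V} p {} + 1"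
    using card_V by (cases p) auto
  have "can_force E (\<lambda>T. True) t V" for t
    by (rule can_force_invariant[where I = "\<lambda>_. True"]) (auto simp: finite_V empty_not_edge)
  from game_value_le[OF finite_V card_edge this _ M, of 0 "p = Minimizer"]
  show "game_value {e \<in> E. e \<subseteq> V} p {} \<le> n"
    using card_V by (cases p) auto
qed

lemma value_Max_forces:
  assumes "can_force E (\<lambda>T. T = {} \<longleftrightarrow> True) t V"
  shows "game_value {e \<in> E. e \<subseteq> V} (if t then Maximizer else Minimizer) {} = n"
proof -
  have "matching {e \<in> E. e \<subseteq> V} {}" "V = V - \<Union> {}"
    by (auto simp: matching_def)
  from game_value_ge[OF finite_V card_edge assms _ this, of 0]
  show ?thesis
    using card_V value_bounds(2)[of "if t then Maximizer else Minimizer"] by simp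
qed

lemma value_Min_forces:
  assumes "can_force E (\<lambda>T. T = {} \<longleftrightarrow> False) t V"
  shows "Suc (game_value {e \<in> E. e \<subseteq> V} (if t then Minimizer else Maximizer) {}) = n"
proof -
  let ?v = "game_value {e \<in> E. e \<subseteq> V} (if t then Minimizer else Maximizer) {}"
  have M: "matching {e \<in> E. e \<subseteq> V} {}" "V = V - \<Union> {}"
    by (auto simp: matching_def)
  have "can_force E (\<lambda>T. 1 \<le> card T) t V"
    using assms
  \<comment> \<open>An infinite set has \<open>card\<close> 0, so the restriction to subsets of the
    finite \<open>V\<close> is essential here.\<close>
  proof (rule can_force_mono)
    show "1 \<le> card T" if "T \<subseteq> V" "T = {} \<longleftrightarrow> False" for T
      using that finite_subset[OF that(1) finite_V] by (simp add: Suc_leI card_gt_0_iff)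
  qed
  from game_value_le[OF finite_V card_edge this _ M, of 1]
  have "2 * ?v + 1 \<le> 2 * n"
    using card_V by simp
  then show ?thesis
    using value_bounds(1)[of "if t then Minimizer else Maximizer"] by linarith
qed

lemma pair_graph_linked: "pair_graph (induced_pair_graph E V)"
  using finite_V card_edge by (rule pair_graph_induced_pair_graph)

lemma start_numbers:
  "max_start_number (induced_pair_graph E V) = game_value {e \<in> E. e \<subseteq> V} Maximizer {}"
  "min_start_number (induced_pair_graph E V) = game_value {e \<in> E. e \<subseteq> V} Minimizer {}"
  by (simp_all add: max_start_number_def min_start_number_def uedges_induced_pair_graph card_edge)

end

section \<open>The three families of graphs\<close>

text \<open>\<open>P\<close> alone induces a complete graph and is settled from the start: one side
  is even, the other empty.\<close>

lemma complete_graph_numbers: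
  assumes "card P = 2 * r" and "r > 0"
  defines "G \<equiv> induced_pair_graph E P"
  shows "pair_graph G" "Digraph_Component.connected (with_proj G)"
    "max_start_number G = r" "min_start_number G = r"
proof -
  have sub: "P \<subseteq> P \<union> Q \<union> {a, b, c, d}" by auto
  have "settled True P"
    using settled_no_hub[of P "{}" True] assms(1) by simp
  then have *: "can_force E (\<lambda>T. T = {} \<longleftrightarrow> True) t P" for t
    by (rule can_force_settled)
  show "max_start_number G = r" "min_start_number G = r"
    using value_Max_forces[OF sub assms(1) *[of True]] value_Max_forces[OF sub assms(1) *[of False]]
    by (simp_all add: G_def start_numbers[OF sub assms(1)])
  show "pair_graph G"
    unfolding G_def by (rule pair_graph_linked[OF sub assms(1)])
  obtain w where w: "w \<in> P"
    using assms(1,2) by fastforce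
  have "(w, v) \<in> (parcs (induced_pair_graph E P))\<^sup>*" if "v \<in> P" for v
    using w that by (cases "v = w") auto
  then show "Digraph_Component.connected (with_proj G)"
    unfolding G_def using finite_P card_edge w by (intro connected_induced_pair_graph)
qed

text \<open>The starting position is the one treated in \<open>reply_ab\<close>, so the first player
  decides whether the matching is perfect; \<open>s > 0\<close> gives Min the needed clique
  vertex.\<close>

lemma one_link_numbers:
  assumes "card P = s" and "card Q = s" and "s > 0"
  defines "G \<equiv> induced_pair_graph E (P \<union> Q \<union> {c, d})"
  shows "pair_graph G" "Digraph_Component.connected (with_proj G)"
    "max_start_number G = Suc s" "min_start_number G = s"
proof -
  let ?V = "P \<union> Q \<union> {c, d}"
  have sub: "?V \<subseteq> P \<union> Q \<union> {a, b, c, d}" by auto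
  have card: "card ?V = 2 * Suc s"
    using card_hubs(2)[of P Q] assms(1,2) by simp
  have *: "can_force E (\<lambda>T. T = {} \<longleftrightarrow> parity) True ?V" for parity
    using assms(1-3) by (intro reply_ab) auto
  show "max_start_number G = Suc s" "min_start_number G = s"
    using value_Max_forces[OF sub card *[of True]] value_Min_forces[OF sub card *[of False]]
    by (simp_all add: G_def start_numbers[OF sub card] del: Un_insert_right)
  show "pair_graph G"
    unfolding G_def by (rule pair_graph_linked[OF sub card])
  let ?A = "parcs (induced_pair_graph E ?V)"
  \<comment> \<open>From \<open>d\<close> one reaches \<open>P\<close> directly and \<open>Q\<close>
    through \<open>c\<close>.\<close>
  have "(d, x) \<in> ?A" if "x \<in> P" for x
    using that edges(3)[OF that] by (simp add: insert_commute)
  moreover have "(d, c) \<in> ?A"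
    by (simp add: insert_commute)
  moreover have "(c, y) \<in> ?A" if "y \<in> Q" for y
    using that edges(6)[OF that] by (simp add: insert_commute)
  ultimately have "(d, v) \<in> ?A\<^sup>*" if "v \<in> ?V" for v
    using that by (blast intro: rtrancl_trans)
  then show "Digraph_Component.connected (with_proj G)"
    unfolding G_def using finite_V[OF sub card] card_edge by (intro connected_induced_pair_graph[of _ _ d]) auto
qed

text \<open>The false flag in \<open>can_force_second\<close> gives control to the second player.
  For \<open>m = 0\<close> the graph would be two disjoint edges.\<close>

lemma two_link_numbers:
  assumes "card P = m" and "card Q = m" and "m > 0"
  defines "G \<equiv> induced_pair_graph E (P \<union> Q \<union> {a, b, c, d})"
  shows "pair_graph G" "Digraph_Component.connected (with_proj G)"
    "max_start_number G = Suc m" "min_start_number G = Suc (Suc m)"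
proof -
  let ?V = "P \<union> Q \<union> {a, b, c, d}"
  have sub: "?V \<subseteq> P \<union> Q \<union> {a, b, c, d}" by auto
  have card: "card ?V = 2 * Suc (Suc m)"
    using card_hubs(3)[of P Q] assms(1,2) by simp
  have *: "can_force E (\<lambda>T. T = {} \<longleftrightarrow> parity) False ?V" for parity
    using assms(1-3) by (intro can_force_second) auto
  show "max_start_number G = Suc m" "min_start_number G = Suc (Suc m)"
    using value_Max_forces[OF sub card *[of True]] value_Min_forces[OF sub card *[of False]]
    by (simp_all add: G_def start_numbers[OF sub card] del: Un_insert_right)
  show "pair_graph G"
    unfolding G_def by (rule pair_graph_linked[OF sub card])
  let ?A = "parcs (induced_pair_graph E ?V)"
  \<comment> \<open>Since \<open>{a, d}\<close> is missing, \<open>a\<close> and then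
    \<open>b\<close> are reached from \<open>d\<close> by way of \<open>p\<close>.\<close>
  obtain p where p: "p \<in> P"
    using assms(1,3) by fastforce
  have "(d, x) \<in> ?A" if "x \<in> P" for x
    using that edges(3)[OF that] by (simp add: insert_commute)
  moreover have "(p, a) \<in> ?A" "(a, b) \<in> ?A"
    using p by simp_all
  moreover have "(d, c) \<in> ?A"
    using edges(8) by (simp add: insert_commute)
  moreover have "(c, y) \<in> ?A" if "y \<in> Q" for y
    using that edges(6)[OF that] by (simp add: insert_commute)
  ultimately have "(d, v) \<in> ?A\<^sup>*" if "v \<in> ?V" for v
    using that p by (blast intro: rtrancl_trans)
  then show "Digraph_Component.connected (with_proj G)"
    unfolding G_def using finite_V[OF sub card] card_edge by (intro connected_induced_pair_graph[of _ _ d]) auto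
qed

end

section \<open>Realization on the natural numbers\<close>

lemma linked_cliques_nat: "linked_cliques {4..<4 + p} {4 + p..<4 + p + q} 0 1 2 (3 :: nat)"
  by unfold_locales auto

theorem proposition2p1:
  fixes r s :: nat
  assumes "r > 0" and "s > 0"
    and "\<bar>int r - int s\<bar> \<le> 1"
    and "(r, s) \<noteq> (1, 2)"
  shows "\<exists>G :: nat pair_pre_digraph. pair_graph G \<and> Digraph_Component.connected (with_proj G) \<and>
           max_start_number G = r \<and> min_start_number G = s"
proof -
  \<comment> \<open>Excluding \<open>(1, 2)\<close> yields \<open>r > 1\<close> in the last
    case.\<close>
  consider "s = r" | "r = Suc s" | "s = Suc r" "r > 1"
    using assms by fastforce
  then show ?thesis
  proof cases
    case 1
    \<comment> \<open>The second block is empty; its bound \<open>+ 0\<close> matches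
      \<open>linked_cliques_nat\<close> with \<open>q = 0\<close>.\<close>
    interpret linked_cliques "{4..<4 + 2 * r}" "{4 + 2 * r..<4 + 2 * r + 0}" 0 1 2 "3 :: nat"
      by (rule linked_cliques_nat)
    show ?thesis
      using complete_graph_numbers[of r] assms(1) 1 by auto
  next
    case 2
    interpret linked_cliques "{4..<4 + s}" "{4 + s..<4 + s + s}" 0 1 2 "3 :: nat"
      by (rule linked_cliques_nat)
    show ?thesis
      using one_link_numbers[of s] assms(2) 2 by auto
  next
    case 3
    \<comment> \<open>The two-link graph realizes \<open>(m + 1, m + 2)\<close>, hence the shift by
      one; \<open>r > 1\<close> makes \<open>m\<close> positive.\<close>
    define m where "m = r - 1"
    interpret linked_cliques "{4..<4 + m}" "{4 + m..<4 + m + m}" 0 1 2 "3 :: nat"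
      by (rule linked_cliques_nat)
    show ?thesis
      using two_link_numbers[of m] 3 by (auto simp: m_def)
  qed
qed

end
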